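(* Let $\delta$ be either $\delta^{\mathcal{T}}_{\square}$ or $\delta^{\mathcal{T}}_{2}$ (the tree distances of graphs defined in the context). For every tree $T$ and every $\epsilon > 0$ there is an $\eta > 0$ such that, for all graphs $G$ and $H$, if $\delta(G,H) \le \eta$, then $\lvert t(T,G) - t(T,H) \rvert \le \epsilon$.
   Context: Graphs are finite, simple, undirected. For graphs $F,G$, $\hom(F,G)$ is the number of maps $\varphi\colon V(F)\to V(G)$ with $\varphi(u)\varphi(v)\in E(G)$ for all $uv\in E(F)$, and the homomorphism density is $t(F,G)=\hom(F,G)/|V(G)|^{|V(F)|}$. Write $\mathsf{v}(G)=|V(G)|$. A fractional overlay of graphs $G,H$ is a matrix $X\in\mathbb{R}^{V(G)\times V(H)}$ with $X_{uv}\ge 0$, $\sum_{v\in V(H)}X_{uv}=1/\mathsf{v}(G)$ for all $u\in V(G)$ and $\sum_{u\in V(G)}X_{uv}=1/\mathsf{v}(H)$ for all $v\in V(H)$; $\mathcal{X}(G,H)$ is the set of these. The cut norm of a matrix $M\in\mathbb{R}^{m\times n}$ is $\|M\|_\square=\max_{S\subseteq[m],T\subseteq[n]}\lvert\sum_{i\in S,j\in T}M_{ij}\rvert$ and $\|M\|_2$ denotes its spectral (operator $\ell_2$) norm. With $A,B$ the adjacency matrices of $G,H$: $\delta^{\mathcal{T}}_{\square}(G,H)=\inf_{X\in\mathcal{X}(G,H)}\frac{1}{\mathsf{v}(G)\mathsf{v}(H)}\|\mathsf{v}(H)\,AX-\mathsf{v}(G)\,XB\|_\square$ and $\delta^{\mathcal{T}}_{2}(G,H)=\inf_{X\in\mathcal{X}(G,H)}\frac{1}{\sqrt{\mathsf{v}(G)\mathsf{v}(H)}}\|\mathsf{v}(H)\,AX-\mathsf{v}(G)\,XB\|_2$.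 *)

theory Defs
  imports
    "HOL-Library.FuncSet"
    "HOL-Analysis.L2_Norm"
    "Graph_Theory.Digraph_Component"
begin

text \<open>
  A finite simple graph is a \<^locale>\<open>pair_graph\<close>: a finite vertex set together with a symmetric
  irreflexive edge relation, each undirected edge being stored as two opposite arcs.

  The library's \<^const>\<open>tree\<close> is the directed notion, in which the two arcs of an edge already form
  a cycle; an undirected cycle is a \<^const>\<open>pre_digraph.cycle\<close> of length at least 3.
  Connectedness includes that the vertex set is non-empty.
\<close>

definition tree_graph :: "'a pair_pre_digraph \<Rightarrow> bool" where
  "tree_graph T \<longleftrightarrow> pair_graph T \<and> Digraph_Component.connected (with_proj T) \<and>
     \<not> (\<exists>p. pre_digraph.cycle (with_proj T) p \<and> 3 \<le> length p)"

definition graph_order :: "'a pair_pre_digraph \<Rightarrow> nat" where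
  "graph_order G = card (pverts G)"

definition adj_matrix :: "'a pair_pre_digraph \<Rightarrow> 'a \<Rightarrow> 'a \<Rightarrow> real" where
  "adj_matrix G u v = of_bool ((u, v) \<in> parcs G)"

definition graph_homs :: "'a pair_pre_digraph \<Rightarrow> 'b pair_pre_digraph \<Rightarrow> ('a \<Rightarrow> 'b) set" where
  "graph_homs F G =
     {\<phi> \<in> pverts F \<rightarrow>\<^sub>E pverts G. \<forall>u v. (u, v) \<in> parcs F \<longrightarrow> (\<phi> u, \<phi> v) \<in> parcs G}"

definition hom_density :: "'a pair_pre_digraph \<Rightarrow> 'b pair_pre_digraph \<Rightarrow> real" where
  "hom_density F G = real (card (graph_homs F G)) / real (graph_order G) ^ graph_order F"

text \<open>
  A matrix with rows indexed by \<open>U\<close> and columns indexed by \<open>W\<close> is a function of two arguments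
  of which only the entries in \<open>U \<times> W\<close> matter.
\<close>

definition cut_norm :: "'a set \<Rightarrow> 'b set \<Rightarrow> ('a \<Rightarrow> 'b \<Rightarrow> real) \<Rightarrow> real" where
  "cut_norm U W M = Max {\<bar>\<Sum>i\<in>S. \<Sum>j\<in>T. M i j\<bar> | S T. S \<subseteq> U \<and> T \<subseteq> W}"

definition spectral_norm :: "'a set \<Rightarrow> 'b set \<Rightarrow> ('a \<Rightarrow> 'b \<Rightarrow> real) \<Rightarrow> real" where
  "spectral_norm U W M = (SUP x\<in>{x. L2_set x W \<le> 1}. L2_set (\<lambda>i. \<Sum>j\<in>W. M i j * x j) U)"

definition fractional_overlays ::
    "'a pair_pre_digraph \<Rightarrow> 'b pair_pre_digraph \<Rightarrow> ('a \<Rightarrow> 'b \<Rightarrow> real) set" where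
  "fractional_overlays G H = {X.
     (\<forall>u\<in>pverts G. \<forall>v\<in>pverts H. 0 \<le> X u v) \<and>
     (\<forall>u\<in>pverts G. (\<Sum>v\<in>pverts H. X u v) = 1 / real (graph_order G)) \<and>
     (\<forall>v\<in>pverts H. (\<Sum>u\<in>pverts G. X u v) = 1 / real (graph_order H))}"

text \<open>The matrix \<open>v(H) A X - v(G) X B\<close>, where \<open>A\<close>, \<open>B\<close> are the adjacency matrices of \<open>G\<close>, \<open>H\<close>.\<close>

definition overlay_defect ::
    "'a pair_pre_digraph \<Rightarrow> 'b pair_pre_digraph \<Rightarrow> ('a \<Rightarrow> 'b \<Rightarrow> real) \<Rightarrow> 'a \<Rightarrow> 'b \<Rightarrow> real" where
  "overlay_defect G H X u v =
     real (graph_order H) * (\<Sum>u'\<in>pverts G. adj_matrix G u u' * X u' v) -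
     real (graph_order G) * (\<Sum>v'\<in>pverts H. X u v' * adj_matrix H v' v)"

definition tree_cut_dist :: "'a pair_pre_digraph \<Rightarrow> 'b pair_pre_digraph \<Rightarrow> real" where
  "tree_cut_dist G H = (INF X\<in>fractional_overlays G H.
     1 / (real (graph_order G) * real (graph_order H)) *
     cut_norm (pverts G) (pverts H) (overlay_defect G H X))"

definition tree_spectral_dist :: "'a pair_pre_digraph \<Rightarrow> 'b pair_pre_digraph \<Rightarrow> real" where
  "tree_spectral_dist G H = (INF X\<in>fractional_overlays G H.
     1 / sqrt (real (graph_order G) * real (graph_order H)) *
     spectral_norm (pverts G) (pverts H) (overlay_defect G H X))"

text \<open>
  The infimum on the reals is unspecified on the empty set, so it matters that overlays of
  non-empty graphs exist.
\<close>

lemma fractional_overlays_nonempty: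
  assumes "finite (pverts G)" "pverts G \<noteq> {}" "finite (pverts H)" "pverts H \<noteq> {}"
  shows "fractional_overlays G H \<noteq> {}"
proof -
  have "card (pverts G) > 0" "card (pverts H) > 0"
    using assms by (auto simp: card_gt_0_iff)
  then have "(\<lambda>u v. 1 / (real (graph_order G) * real (graph_order H))) \<in> fractional_overlays G H"
    by (simp add: fractional_overlays_def graph_order_def)
  then show ?thesis by blast
qed

end

theory Submission
  imports Defs
begin

text \<open>
  An overlay \<open>X\<close> is a coupling of the uniform distributions on the vertices of \<open>G\<close> and \<open>H\<close>. If
  functions \<open>f\<close> on \<open>G\<close> and \<open>h\<close> on \<open>H\<close> with values in \<open>[0, 1]\<close> are close in expectation under \<open>X\<close>,
  then so are their products with such functions, and so are their normalised neighbourhood sums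
  \<open>F\<close> and \<open>K\<close>: writing \<open>(F - K)\<^sup>2 = F (F - K) + K (K - F)\<close>, the expectation of \<open>F (F - K)\<close> turns, by
  commuting \<open>X\<close> past the adjacency matrices, into a term controlled by the distance of \<open>f\<close> and \<open>h\<close>
  plus the defect tested against \<open>F\<close> and \<open>h\<close>, which the cut norm controls. A vertex-weighted
  homomorphism density of a tree is unchanged when a leaf is removed and the weight of its neighbour
  is multiplied by the neighbourhood average of the weight of the leaf, so stability under the cut
  distance follows by induction. The spectral norm dominates the cut norm after normalisation.
\<close>

text \<open>The sum is divided by the order of \<open>G\<close>, not by a degree: this is
  \<open>A f / n\<close>, the integral operator of the step graphon of \<open>G\<close>.\<close>

definition nbr_avg :: "'a pair_pre_digraph \<Rightarrow> ('a \<Rightarrow> real) \<Rightarrow> 'a \<Rightarrow> real" where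
  "nbr_avg G f u = (\<Sum>u'\<in>pverts G. adj_matrix G u u' * f u') / real (graph_order G)"

text \<open>The \<open>L^1\<close> distance of \<open>f\<close> and \<open>h\<close> when
  \<open>X\<close> is read as a coupling of uniform vertices.\<close>

definition overlay_gap ::
    "'a pair_pre_digraph \<Rightarrow> 'b pair_pre_digraph \<Rightarrow> ('a \<Rightarrow> 'b \<Rightarrow> real) \<Rightarrow>
      ('a \<Rightarrow> real) \<Rightarrow> ('b \<Rightarrow> real) \<Rightarrow> real" where
  "overlay_gap G H X f h = (\<Sum>u\<in>pverts G. \<Sum>v\<in>pverts H. X u v * \<bar>f u - h v\<bar>)"

section \<open>Cut norm, its bilinear form, and comparison with the spectral norm\<close>

lemma finite_cut_values:
  assumes "finite U" "finite W"
  shows "finite {\<bar>\<Sum>i\<in>S. \<Sum>j\<in>T. M i j\<bar> | S T. S \<subseteq> U \<and> T \<subseteq> W}"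
proof -
  have "{\<bar>\<Sum>i\<in>S. \<Sum>j\<in>T. M i j\<bar> | S T. S \<subseteq> U \<and> T \<subseteq> W} =
        (\<lambda>(S, T). \<bar>\<Sum>i\<in>S. \<Sum>j\<in>T. M i j\<bar>) ` (Pow U \<times> Pow W)"
    by auto
  then show ?thesis using assms by simp
qed

lemma cut_norm_ge:
  assumes "finite U" "finite W" "S \<subseteq> U" "T \<subseteq> W"
  shows "\<bar>\<Sum>i\<in>S. \<Sum>j\<in>T. M i j\<bar> \<le> cut_norm U W M"
  unfolding cut_norm_def using assms by (intro Max_ge finite_cut_values) auto

lemma cut_norm_leI:
  assumes "finite U" "finite W"
    and "\<And>S T. S \<subseteq> U \<Longrightarrow> T \<subseteq> W \<Longrightarrow> \<bar>\<Sum>i\<in>S. \<Sum>j\<in>T. M i j\<bar> \<le> c"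
  shows "cut_norm U W M \<le> c"
  unfolding cut_norm_def using assms(3)
  by (subst Max_le_iff[OF finite_cut_values[OF assms(1,2)]]) auto

text \<open>Exchanging the two graphs transposes the defect matrix and changes its sign; the
  absolute value absorbs the sign.\<close>

lemma cut_norm_transpose_minus: "cut_norm W U (\<lambda>j i. - M i j) = cut_norm U W M"
proof -
  have "\<bar>\<Sum>j\<in>T. \<Sum>i\<in>S. - M i j\<bar> = \<bar>\<Sum>i\<in>S. \<Sum>j\<in>T. M i j\<bar>" for S T
    by (subst sum.swap) (simp add: sum_negf)
  then have "{\<bar>\<Sum>j\<in>T. \<Sum>i\<in>S. - M i j\<bar> | T S. T \<subseteq> W \<and> S \<subseteq> U} =
      {\<bar>\<Sum>i\<in>S. \<Sum>j\<in>T. M i j\<bar> | S T. S \<subseteq> U \<and> T \<subseteq> W}"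
    by (simp only:) blast
  then show ?thesis unfolding cut_norm_def by (rule arg_cong)
qed

text \<open>A weighted sum with weights in \<open>[0, 1]\<close> lies between the sum of the
  negative terms and the sum of the positive terms of \<open>c\<close>, so one of these two sets
  serves as \<open>T\<close>.\<close>

lemma unit_weighted_sum_le_subset_sum:
  fixes h c :: "'a \<Rightarrow> real"
  assumes "finite W" "\<And>v. v \<in> W \<Longrightarrow> h v \<in> {0..1}"
  obtains T where "T \<subseteq> W" "\<bar>\<Sum>v\<in>W. h v * c v\<bar> \<le> \<bar>\<Sum>v\<in>T. c v\<bar>"
proof -
  define P where "P = {v \<in> W. c v > 0}"
  define N where "N = {v \<in> W. c v < 0}"
  have "(\<Sum>v\<in>W. h v * c v) \<le> (\<Sum>v\<in>W. if c v > 0 then c v else 0)"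
    using assms(2) by (intro sum_mono) (auto simp: mult_left_le_one_le mult_nonneg_nonpos)
  also have "\<dots> = (\<Sum>v\<in>P. c v)"
    unfolding P_def using assms(1) by (simp add: sum.inter_filter)
  finally have 1: "(\<Sum>v\<in>W. h v * c v) \<le> (\<Sum>v\<in>P. c v)" .
  have "(\<Sum>v\<in>N. c v) = (\<Sum>v\<in>W. if c v < 0 then c v else 0)"
    unfolding N_def using assms(1) by (simp add: sum.inter_filter)
  also have "\<dots> \<le> (\<Sum>v\<in>W. h v * c v)"
  proof (intro sum_mono)
    fix v assume "v \<in> W"
    then have "0 \<le> h v" "h v \<le> 1" using assms(2) by auto
    then show "(if c v < 0 then c v else 0) \<le> h v * c v"
      using mult_right_mono_neg[of "h v" 1 "c v"] by auto
  qed
  finally have 2: "(\<Sum>v\<in>N. c v) \<le> (\<Sum>v\<in>W. h v * c v)" .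
  have "P \<subseteq> W" "N \<subseteq> W" unfolding P_def N_def by auto
  with 1 2 that[of P] that[of N] show thesis by linarith
qed

text \<open>Round the two weights to indicator functions one after the other, first \<open>h\<close>
  to a set of columns, then \<open>F\<close> to a set of rows. As the weights lie in
  \<open>[0, 1]\<close>, no constant factor is lost.\<close>

lemma cut_norm_bilinear:
  fixes F :: "'a \<Rightarrow> real" and h :: "'b \<Rightarrow> real"
  assumes "finite U" "finite W"
    and "\<And>u. u \<in> U \<Longrightarrow> F u \<in> {0..1}" "\<And>v. v \<in> W \<Longrightarrow> h v \<in> {0..1}"
  shows "\<bar>\<Sum>u\<in>U. F u * (\<Sum>v\<in>W. M u v * h v)\<bar> \<le> cut_norm U W M"
proof -
  have "(\<Sum>u\<in>U. F u * (\<Sum>v\<in>W. M u v * h v)) = (\<Sum>u\<in>U. \<Sum>v\<in>W. h v * (F u * M u v))"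
    by (simp add: sum_distrib_left mult_ac)
  also have "\<dots> = (\<Sum>v\<in>W. h v * (\<Sum>u\<in>U. F u * M u v))"
    by (subst sum.swap) (simp add: sum_distrib_left)
  finally have eq: "(\<Sum>u\<in>U. F u * (\<Sum>v\<in>W. M u v * h v)) = (\<Sum>v\<in>W. h v * (\<Sum>u\<in>U. F u * M u v))" .
  obtain T where T: "T \<subseteq> W"
    "\<bar>\<Sum>v\<in>W. h v * (\<Sum>u\<in>U. F u * M u v)\<bar> \<le> \<bar>\<Sum>v\<in>T. \<Sum>u\<in>U. F u * M u v\<bar>"
    by (rule unit_weighted_sum_le_subset_sum[OF assms(2,4)])
  obtain S where S: "S \<subseteq> U"
    "\<bar>\<Sum>u\<in>U. F u * (\<Sum>v\<in>T. M u v)\<bar> \<le> \<bar>\<Sum>u\<in>S. \<Sum>v\<in>T. M u v\<bar>"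
    by (rule unit_weighted_sum_le_subset_sum[OF assms(1,3)])
  have "(\<Sum>v\<in>T. \<Sum>u\<in>U. F u * M u v) = (\<Sum>u\<in>U. F u * (\<Sum>v\<in>T. M u v))"
    by (subst sum.swap) (simp add: sum_distrib_left)
  with eq T(2) S(2) cut_norm_ge[OF assms(1,2) S(1) T(1), of M] show ?thesis by linarith
qed

text \<open>The real supremum is an upper bound only once boundedness is known. A crude bound does:
  coordinates in the unit ball are at most 1 in absolute value, so the sum of all
  \<open>\<bar>M i j\<bar>\<close> suffices.\<close>

lemma L2_set_le_spectral_norm:
  fixes x :: "'b \<Rightarrow> real"
  assumes "finite U" "finite W" "L2_set x W \<le> 1"
  shows "L2_set (\<lambda>i. \<Sum>j\<in>W. M i j * x j) U \<le> spectral_norm U W M"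
  unfolding spectral_norm_def
proof (rule cSUP_upper)
  show "x \<in> {x. L2_set x W \<le> 1}" using assms by simp
  show "bdd_above ((\<lambda>x. L2_set (\<lambda>i. \<Sum>j\<in>W. M i j * x j) U) ` {x. L2_set x W \<le> 1})"
  proof (rule bdd_aboveI2)
    fix x :: "'b \<Rightarrow> real" assume "x \<in> {x. L2_set x W \<le> 1}"
    then have "L2_set (\<lambda>j. \<bar>x j\<bar>) W \<le> 1" by (simp add: L2_set_def)
    then have x: "\<bar>x j\<bar> \<le> 1" if "j \<in> W" for j
      using member_le_L2_set[OF assms(2) that, of "\<lambda>j. \<bar>x j\<bar>"] by linarith
    have "L2_set (\<lambda>i. \<Sum>j\<in>W. M i j * x j) U \<le> (\<Sum>i\<in>U. \<bar>\<Sum>j\<in>W. M i j * x j\<bar>)"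
      by (rule L2_set_le_sum_abs)
    also have "\<dots> \<le> (\<Sum>i\<in>U. \<Sum>j\<in>W. \<bar>M i j\<bar>)"
    proof (intro sum_mono order_trans[OF sum_abs])
      fix i j assume "j \<in> W"
      with x show "\<bar>M i j * x j\<bar> \<le> \<bar>M i j\<bar>" by (simp add: abs_mult mult_left_le)
    qed
    finally show "L2_set (\<lambda>i. \<Sum>j\<in>W. M i j * x j) U \<le> (\<Sum>i\<in>U. \<Sum>j\<in>W. \<bar>M i j\<bar>)" .
  qed
qed

text \<open>Apply \<open>M\<close> to the indicator of \<open>T\<close> and pair the result with the
  all-ones vector on \<open>U\<close> by Cauchy-Schwarz. The two vectors contribute the two square
  roots.\<close>

lemma cut_norm_le_spectral_norm:
  assumes U: "finite U" and W: "finite W" "W \<noteq> {}"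
  shows "cut_norm U W M \<le> sqrt (real (card U) * real (card W)) * spectral_norm U W M"
proof (rule cut_norm_leI[OF U W(1)])
  fix S T assume ST: "S \<subseteq> U" "T \<subseteq> W"
  have m: "card W > 0" using W by (simp add: card_gt_0_iff)
  \<comment> \<open>Scaling by the size of \<open>W\<close> rather than of \<open>T\<close> keeps
    \<open>x\<close> in the unit ball for every \<open>T\<close>, including the empty set.\<close>
  define x where "x j = of_bool (j \<in> T) / sqrt (real (card W))" for j
  have xT: "(\<Sum>j\<in>W. M i j * x j) = (\<Sum>j\<in>T. M i j) / sqrt (real (card W))" for i
  proof -
    have "(\<Sum>j\<in>W. M i j * x j) = (\<Sum>j\<in>W. of_bool (j \<in> T) * M i j) / sqrt (real (card W))"
      by (simp add: x_def sum_divide_distrib mult.commute)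
    also have "(\<Sum>j\<in>W. of_bool (j \<in> T) * M i j) = (\<Sum>j\<in>T. M i j)"
      using W(1) ST(2) by (intro sum.mono_neutral_cong_right) auto
    finally show ?thesis .
  qed
  have "(\<Sum>j\<in>W. (x j)\<^sup>2) \<le> (\<Sum>j\<in>W. 1 / real (card W))"
    by (intro sum_mono) (auto simp: x_def power_divide)
  also have "\<dots> = 1" using m by simp
  finally have x1: "L2_set x W \<le> 1" by (simp add: L2_set_def)
  have "\<bar>\<Sum>i\<in>S. \<Sum>j\<in>T. M i j\<bar> \<le> (\<Sum>i\<in>S. \<bar>\<Sum>j\<in>T. M i j\<bar>)" by (rule sum_abs)
  also have "\<dots> \<le> (\<Sum>i\<in>U. \<bar>1\<bar> * \<bar>\<Sum>j\<in>T. M i j\<bar>)"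
    using U ST by (simp add: sum_mono2)
  also have "\<dots> \<le> L2_set (\<lambda>_. 1) U * L2_set (\<lambda>i. \<Sum>j\<in>T. M i j) U"
    by (rule L2_set_mult_ineq)
  also have "L2_set (\<lambda>_. 1 :: real) U * L2_set (\<lambda>i. \<Sum>j\<in>T. M i j) U =
      L2_set (\<lambda>_. 1) U * L2_set (\<lambda>i. sqrt (real (card W)) * (\<Sum>j\<in>W. M i j * x j)) U"
    using m by (simp add: xT)
  also have "L2_set (\<lambda>_. 1 :: real) U * L2_set (\<lambda>i. sqrt (real (card W)) * (\<Sum>j\<in>W. M i j * x j)) U
      = sqrt (real (card U) * real (card W)) * L2_set (\<lambda>i. \<Sum>j\<in>W. M i j * x j) U"
    by (simp add: L2_set_right_distrib[symmetric] real_sqrt_mult L2_set_def[of "\<lambda>_. 1"])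
  also have "\<dots> \<le> sqrt (real (card U) * real (card W)) * spectral_norm U W M"
    using L2_set_le_spectral_norm[OF U W(1) x1] by (intro mult_left_mono) auto
  finally show "\<bar>\<Sum>i\<in>S. \<Sum>j\<in>T. M i j\<bar> \<le>
    sqrt (real (card U) * real (card W)) * spectral_norm U W M" .
qed

section \<open>The normalised defect of a single overlay\<close>

text \<open>The quantity whose infimum over all overlays is \<open>tree_cut_dist\<close>.\<close>

definition cut_defect :: "'a pair_pre_digraph \<Rightarrow> 'b pair_pre_digraph \<Rightarrow> ('a \<Rightarrow> 'b \<Rightarrow> real) \<Rightarrow> real"
  where "cut_defect G H X = cut_norm (pverts G) (pverts H) (overlay_defect G H X) /
    (real (graph_order G) * real (graph_order H))"

text \<open>The only place where the two distances are told apart: both yield an overlay of small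
  \<open>cut_defect\<close>, and the rest works with that overlay. The strict bound on the infimum
  avoids asking whether it is attained.\<close>

lemma cut_defect_le_of_tree_dist:
  assumes "\<delta> = tree_cut_dist \<or> \<delta> = tree_spectral_dist"
    and "finite (pverts G)" "pverts G \<noteq> {}" "finite (pverts H)" "pverts H \<noteq> {}"
    and "\<delta> G H < c"
  obtains X where "X \<in> fractional_overlays G H" "cut_defect G H X \<le> c"
proof -
  note ne = fractional_overlays_nonempty[OF assms(2-5)]
  let ?q = "real (graph_order G) * real (graph_order H)"
  let ?c = "\<lambda>X. cut_norm (pverts G) (pverts H) (overlay_defect G H X)"
  let ?s = "\<lambda>X. spectral_norm (pverts G) (pverts H) (overlay_defect G H X)"
  have q: "?q > 0" using assms(2-5) by (simp add: graph_order_def card_gt_0_iff)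
  consider "tree_cut_dist G H < c" | "tree_spectral_dist G H < c"
    using assms(1,6) by auto
  then show thesis
  proof cases
    case 1
    then have "\<exists>y\<in>(\<lambda>X. 1 / ?q * ?c X) ` fractional_overlays G H. y < c"
      unfolding tree_cut_dist_def using ne by (intro cInf_lessD) auto
    then obtain X where "X \<in> fractional_overlays G H" "1 / ?q * ?c X < c" by blast
    then show thesis by (intro that[of X]) (auto simp: cut_defect_def)
  next
    case 2
    then have "\<exists>y\<in>(\<lambda>X. 1 / sqrt ?q * ?s X) ` fractional_overlays G H. y < c"
      unfolding tree_spectral_dist_def using ne by (intro cInf_lessD) auto
    then obtain X where X: "X \<in> fractional_overlays G H" "1 / sqrt ?q * ?s X < c" by blast
    \<comment> \<open>Dividing \<open>sqrt ?q\<close> by \<open>?q\<close> leaves exactly the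
      normalisation of \<open>tree_spectral_dist\<close>.\<close>
    have "cut_defect G H X \<le> (sqrt ?q * ?s X) / ?q"
      unfolding cut_defect_def
      using cut_norm_le_spectral_norm[OF assms(2,4,5), of "overlay_defect G H X"] q
      by (intro divide_right_mono) (auto simp: graph_order_def)
    also have "\<dots> = 1 / sqrt ?q * ?s X"
      using sqrt_divide_self_eq[of ?q] q by (simp add: divide_inverse mult_ac)
    finally show thesis using X by (intro that[of X]) auto
  qed
qed

section \<open>Exchanging the two graphs\<close>

lemma fractional_overlays_transpose:
  "X \<in> fractional_overlays G H \<Longrightarrow> (\<lambda>v u. X u v) \<in> fractional_overlays H G"
  by (auto simp: fractional_overlays_def)

text \<open>For symmetric \<open>A\<close> and \<open>B\<close>, the transpose of
  \<open>m A X - n X B\<close> is \<open>m X' A - n B X'\<close> with \<open>X'\<close> the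
  transpose of \<open>X\<close>, which is minus the defect of \<open>X'\<close>.\<close>

lemma cut_defect_transpose:
  assumes "sym (parcs G)" "sym (parcs H)"
  shows "cut_defect H G (\<lambda>v u. X u v) = cut_defect G H X"
proof -
  have A: "adj_matrix G u v = adj_matrix G v u" for u v
    using assms(1) by (auto simp: adj_matrix_def dest: symD)
  have B: "adj_matrix H u v = adj_matrix H v u" for u v
    using assms(2) by (auto simp: adj_matrix_def dest: symD)
  have "overlay_defect H G (\<lambda>v u. X u v) v u = - overlay_defect G H X u v" for u v
    unfolding overlay_defect_def
    using A[of u] B[of _ v] by (simp add: mult.commute)
  then have "overlay_defect H G (\<lambda>v u. X u v) = (\<lambda>v u. - overlay_defect G H X u v)"
    by auto
  then show ?thesis by (simp add: cut_defect_def cut_norm_transpose_minus mult.commute)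
qed

lemma overlay_gap_transpose: "overlay_gap H G (\<lambda>v u. X u v) h f = overlay_gap G H X f h"
  unfolding overlay_gap_def by (subst sum.swap) (simp add: abs_minus_commute)

section \<open>Neighbourhood averages under an overlay\<close>

lemma nbr_avg_unit:
  assumes "finite (pverts G)" "pverts G \<noteq> {}" "\<And>u. u \<in> pverts G \<Longrightarrow> f u \<in> {0..1}"
  shows "nbr_avg G f u \<in> {0..1}"
proof -
  have "adj_matrix G u u' * f u' \<in> {0..1}" if "u' \<in> pverts G" for u'
    using assms(3)[OF that] by (auto simp: adj_matrix_def)
  moreover have "0 < real (card (pverts G))" using assms(1,2) by (simp add: card_gt_0_iff)
  ultimately show ?thesis
    using sum_nonneg[of "pverts G" "\<lambda>u'. adj_matrix G u u' * f u'"]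
      sum_bounded_above[of "pverts G" "\<lambda>u'. adj_matrix G u u' * f u'" 1]
    by (auto simp: nbr_avg_def graph_order_def divide_simps)
qed

text \<open>The factor \<open>F\<close> tests the difference of the averages from the side of
  \<open>G\<close>. Moving \<open>X\<close> past the adjacency matrices turns that difference into
  \<open>A\<close> applied to the difference of \<open>f\<close> and \<open>h\<close>, plus a defect
  term that the cut norm bounds.\<close>

lemma nbr_avg_overlay_one_sided:
  assumes G: "finite (pverts G)" "pverts G \<noteq> {}" and H: "finite (pverts H)" "pverts H \<noteq> {}"
    and X: "X \<in> fractional_overlays G H"
    and h: "\<And>v. v \<in> pverts H \<Longrightarrow> h v \<in> {0..1}"
    and F: "\<And>u. u \<in> pverts G \<Longrightarrow> F u \<in> {0..1}"
  shows "(\<Sum>u\<in>pverts G. \<Sum>v\<in>pverts H. X u v * (F u * (nbr_avg G f u - nbr_avg H h v)))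
    \<le> overlay_gap G H X f h + cut_defect G H X"
proof -
  let ?U = "pverts G" and ?W = "pverts H"
  define n where "n = real (graph_order G)"
  define m where "m = real (graph_order H)"
  have n: "n > 0" and m: "m > 0"
    using G H by (simp_all add: n_def m_def graph_order_def card_gt_0_iff)
  have X0: "0 \<le> X u v" if "u \<in> ?U" "v \<in> ?W" for u v
    using X that by (auto simp: fractional_overlays_def)
  have X1: "(\<Sum>v\<in>?W. X u v) = 1 / n" if "u \<in> ?U" for u
    using X that by (auto simp: fractional_overlays_def n_def)
  let ?A = "adj_matrix G" and ?B = "adj_matrix H" and ?D = "overlay_defect G H X"
  \<comment> \<open>With \<open>D\<close> the defect,
    \<open>X B h / m = A X h / n - D h / (n m)\<close>. The row sums of \<open>X\<close> are
    constant, so the average of \<open>f\<close> can likewise be written with \<open>X\<close> to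
    the right of \<open>A\<close>.\<close>
  have row: "(\<Sum>v\<in>?W. X u v * (nbr_avg G f u - nbr_avg H h v)) =
      (1 / n) * (\<Sum>u'\<in>?U. ?A u u' * (\<Sum>v\<in>?W. X u' v * (f u' - h v))) +
      (\<Sum>v\<in>?W. ?D u v * h v) / (n * m)" if u: "u \<in> ?U" for u
  proof -
    have 1: "(\<Sum>v\<in>?W. X u v * nbr_avg G f u) = (1 / n) * (\<Sum>u'\<in>?U. ?A u u' * (\<Sum>v\<in>?W. X u' v * f u'))"
    proof -
      have "(\<Sum>v\<in>?W. X u' v * f u') = 1 / n * f u'" if "u' \<in> ?U" for u'
        by (simp add: X1 that flip: sum_distrib_right)
      then have "(\<Sum>u'\<in>?U. ?A u u' * (\<Sum>v\<in>?W. X u' v * f u')) = nbr_avg G f u"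
        by (simp add: nbr_avg_def n_def[symmetric] sum_divide_distrib)
      then show ?thesis by (simp add: X1 u flip: sum_distrib_right)
    qed
    have 2: "(\<Sum>v\<in>?W. X u v * nbr_avg H h v) = (\<Sum>v\<in>?W. (\<Sum>v'\<in>?W. X u v' * ?B v' v) * h v) / m"
      unfolding nbr_avg_def m_def[symmetric]
      by (simp add: sum_divide_distrib sum_distrib_left sum_distrib_right mult_ac)
        (subst sum.swap, simp)
    have "(\<Sum>v\<in>?W. (\<Sum>u'\<in>?U. ?A u u' * X u' v) * h v) = (\<Sum>u'\<in>?U. ?A u u' * (\<Sum>v\<in>?W. X u' v * h v))"
      by (simp add: sum_distrib_left sum_distrib_right mult_ac) (subst sum.swap, simp)
    then have "(\<Sum>v\<in>?W. ?D u v * h v) =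
        m * (\<Sum>u'\<in>?U. ?A u u' * (\<Sum>v\<in>?W. X u' v * h v)) -
        n * (\<Sum>v\<in>?W. (\<Sum>v'\<in>?W. X u v' * ?B v' v) * h v)"
      by (simp add: overlay_defect_def n_def[symmetric] m_def[symmetric] left_diff_distrib
        sum_subtractf mult.assoc flip: sum_distrib_left)
    then have 3: "(\<Sum>v\<in>?W. ?D u v * h v) / (n * m) =
        (1 / n) * (\<Sum>u'\<in>?U. ?A u u' * (\<Sum>v\<in>?W. X u' v * h v)) -
        (\<Sum>v\<in>?W. (\<Sum>v'\<in>?W. X u v' * ?B v' v) * h v) / m"
      using n m by (simp add: field_simps)
    show ?thesis
      unfolding 3 using 1 2 by (simp add: right_diff_distrib sum_subtractf)
  qed
  \<comment> \<open>Since \<open>F\<close> and the entries of \<open>A\<close> lie in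
    \<open>[0, 1]\<close>, each row costs at most \<open>1 / n\<close> times the gap; the
    \<open>n\<close> rows together cost it once.\<close>
  have row_le: "F u * (\<Sum>v\<in>?W. X u v * (nbr_avg G f u - nbr_avg H h v)) \<le>
      (1 / n) * overlay_gap G H X f h + F u * (\<Sum>v\<in>?W. ?D u v * h v) / (n * m)" if u: "u \<in> ?U" for u
  proof -
    have "F u * (\<Sum>u'\<in>?U. ?A u u' * (\<Sum>v\<in>?W. X u' v * (f u' - h v))) \<le> overlay_gap G H X f h"
      unfolding overlay_gap_def sum_distrib_left
    proof (intro sum_mono)
      fix u' v assume uv: "u' \<in> ?U" "v \<in> ?W"
      have "F u * (?A u u' * (X u' v * (f u' - h v))) \<le> \<bar>F u * ?A u u'\<bar> * (X u' v * \<bar>f u' - h v\<bar>)"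
        using X0[OF uv] by (metis abs_ge_self abs_mult abs_of_nonneg mult.assoc)
      also have "\<dots> \<le> 1 * (X u' v * \<bar>f u' - h v\<bar>)"
        using F[OF u] X0[OF uv] by (intro mult_right_mono) (auto simp: adj_matrix_def)
      finally show "F u * (?A u u' * (X u' v * (f u' - h v))) \<le> X u' v * \<bar>f u' - h v\<bar>" by simp
    qed
    then have "(1 / n) * (F u * (\<Sum>u'\<in>?U. ?A u u' * (\<Sum>v\<in>?W. X u' v * (f u' - h v))))
        \<le> (1 / n) * overlay_gap G H X f h"
      using n by (intro mult_left_mono) auto
    then show ?thesis unfolding row[OF u] by (simp add: distrib_left mult_ac)
  qed
  have "\<bar>\<Sum>u\<in>?U. F u * (\<Sum>v\<in>?W. ?D u v * h v)\<bar> \<le> cut_norm ?U ?W ?D"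
    by (rule cut_norm_bilinear[OF G(1) H(1) F h])
  then have "(\<Sum>u\<in>?U. F u * (\<Sum>v\<in>?W. ?D u v * h v)) / (n * m) \<le> cut_defect G H X"
    unfolding cut_defect_def n_def[symmetric] m_def[symmetric]
    using n m by (intro divide_right_mono) auto
  moreover have "(\<Sum>u\<in>?U. (1 / n) * overlay_gap G H X f h) = overlay_gap G H X f h"
    using n by (simp add: n_def graph_order_def)
  moreover have "(\<Sum>u\<in>?U. \<Sum>v\<in>?W. X u v * (F u * (nbr_avg G f u - nbr_avg H h v))) =
      (\<Sum>u\<in>?U. F u * (\<Sum>v\<in>?W. X u v * (nbr_avg G f u - nbr_avg H h v)))"
    by (simp add: sum_distrib_left mult_ac)
  moreover have "(\<Sum>u\<in>?U. F u * (\<Sum>v\<in>?W. X u v * (nbr_avg G f u - nbr_avg H h v))) \<le>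
      (\<Sum>u\<in>?U. (1 / n) * overlay_gap G H X f h + F u * (\<Sum>v\<in>?W. ?D u v * h v) / (n * m))"
    by (rule sum_mono) (rule row_le)
  ultimately show ?thesis
    unfolding sum.distrib sum_divide_distrib[symmetric] by linarith
qed

text \<open>The one-sided bound, used once from each side, controls the second moment of the
  difference. The inequality \<open>2 t a \<le> t\<^sup>2 + a\<^sup>2\<close> then gives the first
  moment; \<open>t\<close> is left free for the later choice of constants.\<close>

lemma overlay_gap_nbr_avg:
  assumes G: "finite (pverts G)" "pverts G \<noteq> {}" "sym (parcs G)"
    and H: "finite (pverts H)" "pverts H \<noteq> {}" "sym (parcs H)"
    and X: "X \<in> fractional_overlays G H"
    and f: "\<And>u. u \<in> pverts G \<Longrightarrow> f u \<in> {0..1}"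
    and h: "\<And>v. v \<in> pverts H \<Longrightarrow> h v \<in> {0..1}"
    and t: "t > 0"
  shows "overlay_gap G H X (nbr_avg G f) (nbr_avg H h)
    \<le> t / 2 + (overlay_gap G H X f h + cut_defect G H X) / t"
proof -
  let ?U = "pverts G" and ?W = "pverts H"
  let ?F = "nbr_avg G f" and ?K = "nbr_avg H h"
  have X0: "0 \<le> X u v" if "u \<in> ?U" "v \<in> ?W" for u v
    using X that by (auto simp: fractional_overlays_def)
  have "(\<Sum>u\<in>?U. \<Sum>v\<in>?W. X u v) = 1"
    using X G by (auto simp: fractional_overlays_def graph_order_def)
  then have mass: "(\<Sum>u\<in>?U. \<Sum>v\<in>?W. X u v * (t / 2)) = t / 2"
    by (simp add: sum_distrib_right[symmetric] flip: sum_divide_distrib)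
  have 1: "(\<Sum>u\<in>?U. \<Sum>v\<in>?W. X u v * (?F u * (?F u - ?K v))) \<le> overlay_gap G H X f h + cut_defect G H X"
    by (rule nbr_avg_overlay_one_sided) (use G H X h nbr_avg_unit[OF G(1,2) f] in auto)
  \<comment> \<open>The same bound for the transposed overlay, with test function \<open>?K\<close>
    on \<open>H\<close>; the symmetry of both graphs brings it back to the gap and defect of
    \<open>X\<close>.\<close>
  have "(\<Sum>v\<in>?W. \<Sum>u\<in>?U. X u v * (?K v * (?K v - ?F u)))
      \<le> overlay_gap H G (\<lambda>v u. X u v) h f + cut_defect H G (\<lambda>v u. X u v)"
    by (rule nbr_avg_overlay_one_sided)
      (use G H fractional_overlays_transpose[OF X] f nbr_avg_unit[OF H(1,2) h] in auto)
  then have 2: "(\<Sum>u\<in>?U. \<Sum>v\<in>?W. X u v * (?K v * (?K v - ?F u))) \<le> overlay_gap G H X f h + cut_defect G H X"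
    by (subst sum.swap)
      (simp only: overlay_gap_transpose[of H G X] cut_defect_transpose[OF G(3) H(3), of X])
  have split: "(\<Sum>u\<in>?U. \<Sum>v\<in>?W. X u v * (?F u - ?K v)\<^sup>2) =
      (\<Sum>u\<in>?U. \<Sum>v\<in>?W. X u v * (?F u * (?F u - ?K v))) +
      (\<Sum>u\<in>?U. \<Sum>v\<in>?W. X u v * (?K v * (?K v - ?F u)))"
    unfolding sum.distrib[symmetric]
    by (intro sum.cong) (auto simp: power2_eq_square algebra_simps)
  have sq: "(\<Sum>u\<in>?U. \<Sum>v\<in>?W. X u v * (?F u - ?K v)\<^sup>2)
      \<le> 2 * (overlay_gap G H X f h + cut_defect G H X)"
    unfolding split mult_2 by (rule add_mono[OF 1 2])
  have "overlay_gap G H X ?F ?K \<le>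
      (\<Sum>u\<in>?U. \<Sum>v\<in>?W. X u v * (t / 2) + X u v * (?F u - ?K v)\<^sup>2 / (2 * t))"
    unfolding overlay_gap_def
  proof (intro sum_mono)
    fix u v assume uv: "u \<in> ?U" "v \<in> ?W"
    have "0 \<le> (t - \<bar>?F u - ?K v\<bar>)\<^sup>2" by simp
    then have "2 * t * \<bar>?F u - ?K v\<bar> \<le> t * t + (?F u - ?K v)\<^sup>2"
      by (simp add: power2_eq_square algebra_simps)
    then have "\<bar>?F u - ?K v\<bar> \<le> t / 2 + (?F u - ?K v)\<^sup>2 / (2 * t)"
      using t by (simp add: field_simps)
    from mult_left_mono[OF this X0[OF uv]]
    show "X u v * \<bar>?F u - ?K v\<bar> \<le> X u v * (t / 2) + X u v * (?F u - ?K v)\<^sup>2 / (2 * t)"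
      by (simp add: distrib_left)
  qed
  also have "\<dots> = t / 2 + (\<Sum>u\<in>?U. \<Sum>v\<in>?W. X u v * (?F u - ?K v)\<^sup>2) / (2 * t)"
    unfolding sum.distrib mass by (simp add: sum_divide_distrib)
  also have "\<dots> \<le> t / 2 + 2 * (overlay_gap G H X f h + cut_defect G H X) / (2 * t)"
    using sq t by (intro add_left_mono divide_right_mono) auto
  finally show ?thesis by (simp del: distrib_left_numeral)
qed

section \<open>Products and means under an overlay\<close>

text \<open>Telescoping as \<open>f1 (f2 - h2) + h2 (f1 - h1)\<close>, which is why the bounds
  concern \<open>f1\<close> and \<open>h2\<close>.\<close>

lemma overlay_gap_mult:
  assumes X: "X \<in> fractional_overlays G H"
    and "\<And>u. u \<in> pverts G \<Longrightarrow> f1 u \<in> {0..1}" "\<And>v. v \<in> pverts H \<Longrightarrow> h2 v \<in> {0..1}"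
  shows "overlay_gap G H X (\<lambda>u. f1 u * f2 u) (\<lambda>v. h1 v * h2 v)
    \<le> overlay_gap G H X f1 h1 + overlay_gap G H X f2 h2"
  unfolding overlay_gap_def sum.distrib[symmetric]
proof (intro sum_mono)
  fix u v assume uv: "u \<in> pverts G" "v \<in> pverts H"
  then have X0: "0 \<le> X u v" using X by (auto simp: fractional_overlays_def)
  have "f1 u * f2 u - h1 v * h2 v = f1 u * (f2 u - h2 v) + h2 v * (f1 u - h1 v)"
    by (simp add: algebra_simps)
  then have "\<bar>f1 u * f2 u - h1 v * h2 v\<bar> \<le> \<bar>f1 u\<bar> * \<bar>f2 u - h2 v\<bar> + \<bar>h2 v\<bar> * \<bar>f1 u - h1 v\<bar>"
    by (metis abs_mult abs_triangle_ineq)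
  also have "\<dots> \<le> 1 * \<bar>f2 u - h2 v\<bar> + 1 * \<bar>f1 u - h1 v\<bar>"
    using assms(2)[OF uv(1)] assms(3)[OF uv(2)] by (intro add_mono mult_right_mono) auto
  finally have "\<bar>f1 u * f2 u - h1 v * h2 v\<bar> \<le> \<bar>f1 u - h1 v\<bar> + \<bar>f2 u - h2 v\<bar>" by simp
  from mult_left_mono[OF this X0]
  show "X u v * \<bar>f1 u * f2 u - h1 v * h2 v\<bar> \<le> X u v * \<bar>f1 u - h1 v\<bar> + X u v * \<bar>f2 u - h2 v\<bar>"
    by (simp add: distrib_left)
qed

text \<open>Both marginals of \<open>X\<close> are uniform, so both means are expectations under the
  one coupling.\<close>

lemma mean_diff_le_overlay_gap:
  assumes X: "X \<in> fractional_overlays G H"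
  shows "\<bar>(\<Sum>u\<in>pverts G. f u) / real (graph_order G) - (\<Sum>v\<in>pverts H. h v) / real (graph_order H)\<bar>
    \<le> overlay_gap G H X f h"
proof -
  have "(\<Sum>u\<in>pverts G. f u) / real (graph_order G) = (\<Sum>u\<in>pverts G. \<Sum>v\<in>pverts H. X u v * f u)"
    using X by (simp add: fractional_overlays_def sum_divide_distrib flip: sum_distrib_right)
  moreover have "(\<Sum>v\<in>pverts H. h v) / real (graph_order H) = (\<Sum>u\<in>pverts G. \<Sum>v\<in>pverts H. X u v * h v)"
    using X by (subst sum.swap) (simp add: fractional_overlays_def sum_divide_distrib flip: sum_distrib_right)
  ultimately have eq: "(\<Sum>u\<in>pverts G. f u) / real (graph_order G) - (\<Sum>v\<in>pverts H. h v) / real (graph_order H)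
      = (\<Sum>u\<in>pverts G. \<Sum>v\<in>pverts H. X u v * (f u - h v))"
    by (simp add: right_diff_distrib sum_subtractf)
  have "\<bar>\<Sum>u\<in>pverts G. \<Sum>v\<in>pverts H. X u v * (f u - h v)\<bar>
      \<le> (\<Sum>u\<in>pverts G. \<Sum>v\<in>pverts H. \<bar>X u v * (f u - h v)\<bar>)"
    by (rule order_trans[OF sum_abs], rule sum_mono, rule sum_abs)
  also have "\<dots> = overlay_gap G H X f h"
    unfolding overlay_gap_def using X
    by (intro sum.cong refl) (auto simp: abs_mult fractional_overlays_def)
  finally show ?thesis using eq by simp
qed

section \<open>Weighted homomorphism densities and leaf removal\<close>

text \<open>The pattern is the part of \<open>E\<close> inside \<open>S\<close>, so that an
  induction can shrink \<open>S\<close> and keep \<open>E\<close> fixed.\<close>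

definition weighted_hom_density ::
    "'a set \<Rightarrow> 'a rel \<Rightarrow> 'b pair_pre_digraph \<Rightarrow> ('a \<Rightarrow> 'b \<Rightarrow> real) \<Rightarrow> real" where
  "weighted_hom_density S E G g =
    (\<Sum>\<phi>\<in>S \<rightarrow>\<^sub>E pverts G.
      of_bool (\<forall>u\<in>S. \<forall>v\<in>S. (u, v) \<in> E \<longrightarrow> (\<phi> u, \<phi> v) \<in> parcs G) * (\<Prod>w\<in>S. g w (\<phi> w))) /
    real (graph_order G) ^ card S"

text \<open>Describes the trees that \<open>E\<close> induces on finite sets: each new vertex
  \<open>l\<close> is a leaf with unique neighbour \<open>p\<close>. Its induction rule is the
  removal of leaves.\<close>

inductive leaf_built :: "'a rel \<Rightarrow> 'a set \<Rightarrow> bool" for E :: "'a rel" where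
  leaf_built_singleton: "leaf_built E {r}"
| leaf_built_insert: "leaf_built E S \<Longrightarrow> p \<in> S \<Longrightarrow> l \<notin> S \<Longrightarrow> (p, l) \<in> E \<Longrightarrow>
    (\<And>q. q \<in> S \<Longrightarrow> (q, l) \<in> E \<Longrightarrow> q = p) \<Longrightarrow> leaf_built E (insert l S)"

lemma leaf_built_finite: "leaf_built E S \<Longrightarrow> finite S"
  by (induction rule: leaf_built.induct) auto

lemma hom_density_eq_weighted:
  assumes "pair_graph T" "finite (pverts G)"
  shows "hom_density T G = weighted_hom_density (pverts T) (parcs T) G (\<lambda>_ _. 1)"
proof -
  interpret T: pair_graph T by fact
  have "finite (pverts T \<rightarrow>\<^sub>E pverts G)"
    using T.pair_finite_verts assms(2) by (intro finite_PiE) auto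
  moreover have "graph_homs T G = {\<phi> \<in> pverts T \<rightarrow>\<^sub>E pverts G.
      \<forall>u\<in>pverts T. \<forall>v\<in>pverts T. (u, v) \<in> parcs T \<longrightarrow> (\<phi> u, \<phi> v) \<in> parcs G}"
    unfolding graph_homs_def using T.in_arcsD1 T.in_arcsD2 by blast
  ultimately have "real (card (graph_homs T G)) = (\<Sum>\<phi>\<in>pverts T \<rightarrow>\<^sub>E pverts G.
      of_bool (\<forall>u\<in>pverts T. \<forall>v\<in>pverts T. (u, v) \<in> parcs T \<longrightarrow> (\<phi> u, \<phi> v) \<in> parcs G))"
    by (simp add: sum_of_bool_eq Int_def)
  then show ?thesis by (simp add: hom_density_def weighted_hom_density_def graph_order_def)
qed

text \<open>Sum over the image of \<open>l\<close> first. Only the image of \<open>p\<close>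
  constrains it, so this inner sum is \<open>n\<close> times the neighbourhood average of
  \<open>g l\<close> there, and the \<open>n\<close> cancels against the larger power in the
  denominator.\<close>

lemma weighted_hom_density_leaf:
  assumes S: "finite S" "p \<in> S" "l \<notin> S"
    and E: "sym E" "irrefl E" "(p, l) \<in> E" "\<And>q. q \<in> S \<Longrightarrow> (q, l) \<in> E \<Longrightarrow> q = p"
    and G: "sym (parcs G)" "finite (pverts G)" "pverts G \<noteq> {}"
  shows "weighted_hom_density (insert l S) E G g =
    weighted_hom_density S E G (g(p := \<lambda>x. g p x * nbr_avg G (g l) x))"
proof -
  let ?V = "pverts G"
  let ?hom = "\<lambda>S \<phi>. \<forall>u\<in>S. \<forall>v\<in>S. (u, v) \<in> E \<longrightarrow> (\<phi> u, \<phi> v) \<in> parcs G"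
  define g' where "g' = g(p := \<lambda>x. g p x * nbr_avg G (g l) x)"
  define n where "n = real (graph_order G)"
  have n: "n > 0" using G by (simp add: n_def graph_order_def card_gt_0_iff)
  have hom: "?hom (insert l S) (\<phi>(l := y)) \<longleftrightarrow> ?hom S \<phi> \<and> (\<phi> p, y) \<in> parcs G" for \<phi> y
  proof -
    have 1: "(l, l) \<notin> E" using E(2) by (auto simp: irrefl_def)
    have 2: "(u, l) \<in> E \<longleftrightarrow> u = p" "(l, u) \<in> E \<longleftrightarrow> u = p" if "u \<in> S" for u
      using E that by (auto dest: symD)
    have "?hom (insert l S) (\<phi>(l := y)) \<longleftrightarrow>
        ?hom S \<phi> \<and> (\<forall>u\<in>S. (u, l) \<in> E \<longrightarrow> (\<phi> u, y) \<in> parcs G) \<and> (\<forall>u\<in>S. (l, u) \<in> E \<longrightarrow> (y, \<phi> u) \<in> parcs G)"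
      using 1 S(3) by (auto simp: fun_upd_def)
    also have "\<dots> \<longleftrightarrow> ?hom S \<phi> \<and> (\<phi> p, y) \<in> parcs G"
      using 2 S(2) G(1) by (auto dest: symD)
    finally show ?thesis .
  qed
  \<comment> \<open>A map on \<open>insert l S\<close> is the same as a map \<open>\<phi>\<close> on
    \<open>S\<close> together with an image \<open>y\<close> for \<open>l\<close>.\<close>
  have "(\<Sum>\<phi>\<in>insert l S \<rightarrow>\<^sub>E ?V. of_bool (?hom (insert l S) \<phi>) * (\<Prod>w\<in>insert l S. g w (\<phi> w))) =
      (\<Sum>(y, \<phi>)\<in>?V \<times> (S \<rightarrow>\<^sub>E ?V). of_bool (?hom (insert l S) (\<phi>(l := y))) *
        (\<Prod>w\<in>insert l S. g w ((\<phi>(l := y)) w)))"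
    unfolding PiE_insert_eq using inj_combinator[OF S(3), of "\<lambda>_. ?V"]
    by (subst sum.reindex) (auto simp: case_prod_beta)
  also have "\<dots> = (\<Sum>(y, \<phi>)\<in>?V \<times> (S \<rightarrow>\<^sub>E ?V). of_bool (?hom S \<phi>) * (\<Prod>w\<in>S. g w (\<phi> w)) *
      (adj_matrix G (\<phi> p) y * g l y))"
  proof (intro sum.cong refl, clarify)
    fix y \<phi>
    have "(\<Prod>w\<in>S. g w ((\<phi>(l := y)) w)) = (\<Prod>w\<in>S. g w (\<phi> w))"
      using S(3) by (intro prod.cong) auto
    then have "(\<Prod>w\<in>insert l S. g w ((\<phi>(l := y)) w)) = g l y * (\<Prod>w\<in>S. g w (\<phi> w))"
      using S by simp
    moreover have "of_bool (?hom (insert l S) (\<phi>(l := y))) = of_bool (?hom S \<phi>) * adj_matrix G (\<phi> p) y"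
      by (simp only: hom adj_matrix_def of_bool_conj)
    ultimately show "of_bool (?hom (insert l S) (\<phi>(l := y))) * (\<Prod>w\<in>insert l S. g w ((\<phi>(l := y)) w)) =
        of_bool (?hom S \<phi>) * (\<Prod>w\<in>S. g w (\<phi> w)) * (adj_matrix G (\<phi> p) y * g l y)"
      by (simp only: mult_ac)
  qed
  also have "\<dots> = (\<Sum>\<phi>\<in>S \<rightarrow>\<^sub>E ?V. of_bool (?hom S \<phi>) * (\<Prod>w\<in>S. g w (\<phi> w)) *
      (\<Sum>y\<in>?V. adj_matrix G (\<phi> p) y * g l y))"
    by (simp only: sum.cartesian_product[symmetric] sum_distrib_left) (rule sum.swap)
  also have "\<dots> = n * (\<Sum>\<phi>\<in>S \<rightarrow>\<^sub>E ?V. of_bool (?hom S \<phi>) * (\<Prod>w\<in>S. g' w (\<phi> w)))"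
    unfolding sum_distrib_left[of n]
  proof (intro sum.cong refl)
    fix \<phi>
    have "(\<Prod>w\<in>S. g' w (\<phi> w)) = g' p (\<phi> p) * (\<Prod>w\<in>S - {p}. g w (\<phi> w))"
      using S by (subst prod.remove[of S p]) (auto simp: g'_def intro!: prod.cong)
    also have "\<dots> = nbr_avg G (g l) (\<phi> p) * (\<Prod>w\<in>S. g w (\<phi> w))"
      using prod.remove[OF S(1,2), of "\<lambda>w. g w (\<phi> w)"] by (simp add: g'_def)
    finally have step: "n * (\<Prod>w\<in>S. g' w (\<phi> w)) =
        (\<Sum>y\<in>?V. adj_matrix G (\<phi> p) y * g l y) * (\<Prod>w\<in>S. g w (\<phi> w))"
      using n by (simp add: nbr_avg_def n_def[symmetric])
    show "of_bool (?hom S \<phi>) * (\<Prod>w\<in>S. g w (\<phi> w)) * (\<Sum>y\<in>?V. adj_matrix G (\<phi> p) y * g l y) =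
        n * (of_bool (?hom S \<phi>) * (\<Prod>w\<in>S. g' w (\<phi> w)))"
      by (simp only: mult.left_commute[of n] step) (simp only: mult_ac)
  qed
  finally show ?thesis
    using n S unfolding weighted_hom_density_def g'_def[symmetric] n_def[symmetric] by simp
qed

lemma weighted_hom_density_singleton:
  assumes "irrefl E"
  shows "weighted_hom_density {r} E G g = (\<Sum>x\<in>pverts G. g r x) / real (graph_order G)"
proof -
  have "(\<Sum>\<phi>\<in>{r} \<rightarrow>\<^sub>E pverts G. g r (\<phi> r)) = (\<Sum>x\<in>pverts G. g r x)"
    by (rule sum.reindex_bij_witness[of _ "\<lambda>x. (\<lambda>_. undefined)(r := x)" "\<lambda>\<phi>. \<phi> r"])
      (auto simp: PiE_iff extensional_def fun_eq_iff split: if_splits)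
  then show ?thesis using assms by (simp add: weighted_hom_density_def irrefl_def)
qed

text \<open>The weights are quantified after \<open>\<eta>\<close> because removing a leaf changes
  them: the induction hypothesis is applied to the weights updated at \<open>p\<close>.\<close>

lemma weighted_hom_density_stable:
  fixes E :: "'a rel" and \<epsilon> :: real
  assumes "leaf_built E S" "sym E" "irrefl E" "\<epsilon> > 0"
  shows "\<exists>\<eta>>0. \<forall>(G :: 'b pair_pre_digraph) (H :: 'c pair_pre_digraph) X g k.
    pair_graph G \<longrightarrow> pverts G \<noteq> {} \<longrightarrow> pair_graph H \<longrightarrow> pverts H \<noteq> {} \<longrightarrow>
    X \<in> fractional_overlays G H \<longrightarrow> cut_defect G H X \<le> \<eta> \<longrightarrow>
    (\<forall>w\<in>S. (\<forall>u\<in>pverts G. g w u \<in> {0..1}) \<and> (\<forall>v\<in>pverts H. k w v \<in> {0..1}) \<and>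
      overlay_gap G H X (g w) (k w) \<le> \<eta>) \<longrightarrow>
    \<bar>weighted_hom_density S E G g - weighted_hom_density S E H k\<bar> \<le> \<epsilon>"
  using assms(1)
proof (induction rule: leaf_built.induct)
  case (leaf_built_singleton r)
  show ?case
    using assms(4) mean_diff_le_overlay_gap
    by (intro exI[of _ \<epsilon>]) (fastforce simp: weighted_hom_density_singleton[OF assms(3)] intro: order_trans)
next
  case (leaf_built_insert S p l)
  note S = leaf_built_finite[OF leaf_built_insert.hyps(1)] leaf_built_insert.hyps(2,3)
  note leaf = weighted_hom_density_leaf[OF S assms(2,3) leaf_built_insert.hyps(4,5)]
  obtain \<eta>0 where \<eta>0: "\<eta>0 > 0" and
    IH: "\<And>(G :: 'b pair_pre_digraph) (H :: 'c pair_pre_digraph) X g k.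
      \<lbrakk>pair_graph G; pverts G \<noteq> {}; pair_graph H; pverts H \<noteq> {};
      X \<in> fractional_overlays G H; cut_defect G H X \<le> \<eta>0;
      \<And>w. w \<in> S \<Longrightarrow> (\<forall>u\<in>pverts G. g w u \<in> {0..1}) \<and> (\<forall>v\<in>pverts H. k w v \<in> {0..1}) \<and>
        overlay_gap G H X (g w) (k w) \<le> \<eta>0\<rbrakk> \<Longrightarrow>
      \<bar>weighted_hom_density S E G g - weighted_hom_density S E H k\<bar> \<le> \<epsilon>"
    using leaf_built_insert.IH by metis
  \<comment> \<open>With \<open>\<eta> \<le> t\<^sup>2 / 4\<close> the averages at the leaf have gap
    at most \<open>t / 2 + 2 \<eta> / t \<le> t\<close>. The product at \<open>p\<close> adds at
    most \<open>\<eta> \<le> t\<close>, in total \<open>2 t = \<eta>0\<close>.\<close>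
  define t where "t = \<eta>0 / 2"
  define \<eta> where "\<eta> = min t (t\<^sup>2 / 4)"
  have t: "t > 0" using \<eta>0 by (simp add: t_def)
  then have \<eta>: "\<eta> > 0" "\<eta> \<le> t" "2 * \<eta> / t \<le> t / 2"
    by (auto simp: \<eta>_def field_simps power2_eq_square min_def)
  show ?case
  proof (intro exI[of _ \<eta>] conjI allI impI \<eta>(1))
    fix G :: "'b pair_pre_digraph" and H :: "'c pair_pre_digraph" and X g k
    assume G: "pair_graph G" "pverts G \<noteq> {}" and H: "pair_graph H" "pverts H \<noteq> {}"
      and X: "X \<in> fractional_overlays G H" and cut: "cut_defect G H X \<le> \<eta>"
      and gk: "\<forall>w\<in>insert l S. (\<forall>u\<in>pverts G. g w u \<in> {0..1}) \<and> (\<forall>v\<in>pverts H. k w v \<in> {0..1}) \<and>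
        overlay_gap G H X (g w) (k w) \<le> \<eta>"
    interpret G: pair_graph G by fact
    interpret H: pair_graph H by fact
    have symG: "sym (parcs G)" by (auto intro!: symI G.arcs_symmetric)
    have symH: "sym (parcs H)" by (auto intro!: symI H.arcs_symmetric)
    define g' where "g' = g(p := \<lambda>x. g p x * nbr_avg G (g l) x)"
    define k' where "k' = k(p := \<lambda>x. k p x * nbr_avg H (k l) x)"
    have gl: "nbr_avg G (g l) u \<in> {0..1}" for u
      using gk G by (intro nbr_avg_unit) (auto simp: G.pair_finite_verts)
    have kl: "nbr_avg H (k l) v \<in> {0..1}" for v
      using gk H by (intro nbr_avg_unit) (auto simp: H.pair_finite_verts)
    have "overlay_gap G H X (nbr_avg G (g l)) (nbr_avg H (k l)) \<le>
        t / 2 + (overlay_gap G H X (g l) (k l) + cut_defect G H X) / t"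
      using gk G H X t symG symH
      by (intro overlay_gap_nbr_avg) (auto simp: G.pair_finite_verts H.pair_finite_verts)
    also have "\<dots> \<le> t / 2 + (2 * \<eta>) / t"
    proof -
      have "overlay_gap G H X (g l) (k l) + cut_defect G H X \<le> 2 * \<eta>"
        using bspec[OF gk insertI1] cut by linarith
      then show ?thesis using t by (intro add_left_mono divide_right_mono) auto
    qed
    finally have gap_l: "overlay_gap G H X (nbr_avg G (g l)) (nbr_avg H (k l)) \<le> t"
      using \<eta>(3) by simp
    have "overlay_gap G H X (\<lambda>x. g p x * nbr_avg G (g l) x) (\<lambda>x. k p x * nbr_avg H (k l) x)
        \<le> overlay_gap G H X (g p) (k p) + overlay_gap G H X (nbr_avg G (g l)) (nbr_avg H (k l))"
      using gk S X kl by (intro overlay_gap_mult) auto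
    also have "\<dots> \<le> \<eta>0"
      using bspec[OF gk insertI2[OF S(2)]] gap_l \<eta>(2) unfolding t_def by linarith
    finally have gap_p: "overlay_gap G H X (g' p) (k' p) \<le> \<eta>0" by (simp add: g'_def k'_def)
    have unit: "x * y \<in> {0..1}" if "x \<in> {0..1}" "y \<in> {0..1}" for x y :: real
      using that by (auto intro: mult_le_one)
    have "\<bar>weighted_hom_density S E G g' - weighted_hom_density S E H k'\<bar> \<le> \<epsilon>"
    proof (rule IH[OF G H X])
      show "cut_defect G H X \<le> \<eta>0" using cut \<eta>(2) \<eta>0 by (simp add: t_def)
      fix w assume w: "w \<in> S"
      show "(\<forall>u\<in>pverts G. g' w u \<in> {0..1}) \<and> (\<forall>v\<in>pverts H. k' w v \<in> {0..1}) \<and>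
        overlay_gap G H X (g' w) (k' w) \<le> \<eta>0"
      proof (cases "w = p")
        case True
        have "\<forall>u\<in>pverts G. g' p u \<in> {0..1}" "\<forall>v\<in>pverts H. k' p v \<in> {0..1}"
          using bspec[OF gk insertI2[OF S(2)]] unit gl kl unfolding g'_def k'_def fun_upd_same by blast+
        with gap_p True show ?thesis by blast
      next
        case False
        have "overlay_gap G H X (g w) (k w) \<le> \<eta>0"
          using bspec[OF gk insertI2[OF w]] \<eta>(2) \<eta>0 unfolding t_def by linarith
        with False gk w show ?thesis by (simp add: g'_def k'_def)
      qed
    qed
    then show "\<bar>weighted_hom_density (insert l S) E G g - weighted_hom_density (insert l S) E H k\<bar> \<le> \<epsilon>"
      unfolding g'_def k'_def
      using leaf[OF _ _ symG G.pair_finite_verts G(2)] leaf[OF _ _ symH H.pair_finite_verts H(2)]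
      by simp
  qed
qed

section \<open>Trees are built by attaching leaves\<close>

lemma pawalk_verts_snoc:
  "pcas u q p \<Longrightarrow> pawalk_verts u (q @ [(p, l)]) = pawalk_verts u q @ [l]"
  by (induction q arbitrary: u) auto

text \<open>Extending a path by the arc to a new leaf repeats no vertex. Keeping the path inside
  \<open>S\<close> matters later: it then avoids any outside vertex used to close a cycle.\<close>

lemma (in pair_graph) leaf_built_apath:
  assumes "leaf_built (parcs G) S" "S \<subseteq> pverts G" "u \<in> S" "v \<in> S"
  shows "\<exists>q. apath u q v \<and> set (pawalk_verts u q) \<subseteq> S"
  using assms
proof (induction arbitrary: u v rule: leaf_built.induct)
  case (leaf_built_singleton r)
  then show ?case by (intro exI[of _ "[]"]) (auto simp: apath_Nil_iff)
next
  case (leaf_built_insert S p l)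
  have to_leaf: "\<exists>q. apath u q l \<and> set (pawalk_verts u q) \<subseteq> insert l S" if u: "u \<in> S" for u
  proof -
    obtain q where q: "apath u q p" "set (pawalk_verts u q) \<subseteq> S"
      using leaf_built_insert.IH[of u p] leaf_built_insert.prems(1) leaf_built_insert.hyps(2) u by auto
    then have verts: "pawalk_verts u (q @ [(p, l)]) = pawalk_verts u q @ [l]"
      by (intro pawalk_verts_snoc) (auto simp: apath_def)
    have "awalk u (q @ [(p, l)]) l"
      using q(1) leaf_built_insert.prems(1) leaf_built_insert.hyps(4)
      by (auto simp: apath_def awalk_simps)
    then have "apath u (q @ [(p, l)]) l"
      using q leaf_built_insert.hyps(3) by (auto simp: apath_def verts)
    with q(2) verts show ?thesis by (intro exI[of _ "q @ [(p, l)]"]) auto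
  qed
  show ?case
  proof (cases "v = l")
    case True
    show ?thesis
    proof (cases "u = l")
      case True
      with \<open>v = l\<close> leaf_built_insert.prems show ?thesis
        by (intro exI[of _ "[]"]) (auto simp: apath_Nil_iff)
    next
      case False
      with \<open>v = l\<close> leaf_built_insert.prems to_leaf show ?thesis by auto
    qed
  next
    case False
    then have v: "v \<in> S" using leaf_built_insert.prems by auto
    show ?thesis
    proof (cases "u = l")
      case True
      \<comment> \<open>A path that starts at the leaf is the reversal of one that ends
        there.\<close>
      obtain q where q: "apath v q l" "set (pawalk_verts v q) \<subseteq> insert l S"
        using to_leaf[OF v] by blast
      then have "apath l (rev_path q) v" "pawalk_verts l (rev_path q) = rev (pawalk_verts v q)"
        using awalk_verts_rev_path by (auto simp: apath_def)
      with q True show ?thesis by (intro exI[of _ "rev_path q"]) auto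
    next
      case False
      with v leaf_built_insert.prems leaf_built_insert.IH[of u v] show ?thesis by auto
    qed
  qed
qed

text \<open>Go from \<open>l\<close> to \<open>p\<close>, along \<open>q\<close>, and back from
  \<open>r\<close> to \<open>l\<close>. Since \<open>p \<noteq> r\<close>, the path \<open>q\<close>
  has an arc, so the cycle is not merely an edge traversed both ways.\<close>

lemma (in pair_graph) cycle_of_apath:
  assumes "apath p q r" "p \<noteq> r" "(p, l) \<in> parcs G" "(r, l) \<in> parcs G"
    "l \<notin> set (pawalk_verts p q)"
  shows "\<exists>c. cycle c \<and> 3 \<le> length c"
proof -
  let ?c = "(l, p) # q @ [(r, l)]"
  have "pawalk_verts p (q @ [(r, l)]) = pawalk_verts p q @ [l]"
    using assms(1) by (intro pawalk_verts_snoc) (auto simp: apath_def)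
  moreover have "awalk l ?c l"
    using assms arcs_symmetric by (auto simp: awalk_simps apath_def dest: in_arcsD1 in_arcsD2)
  ultimately have "cycle ?c"
    using assms(1,5) by (auto simp: cycle_def apath_def)
  moreover have "q \<noteq> []" using assms(1,2) by (auto simp: apath_Nil_iff)
  then have "3 \<le> length ?c" by (cases q) auto
  ultimately show ?thesis by blast
qed

text \<open>
  A largest leaf-built set \<open>S\<close> must be everything: an outside vertex adjacent to \<open>S\<close> has a single
  neighbour in \<open>S\<close>, since two of them would be joined by a path inside \<open>S\<close> and close a cycle.
\<close>

lemma tree_graph_leaf_built:
  assumes "tree_graph T"
  shows "leaf_built (parcs T) (pverts T)"
proof -
  interpret T: pair_graph T using assms by (simp add: tree_graph_def)
  have acyclic: "\<not> (\<exists>c. T.cycle c \<and> 3 \<le> length c)"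
    using assms by (auto simp: tree_graph_def)
  \<comment> \<open>Arcs come in opposite pairs, so connectedness gives directed reachability as
    well as a non-empty vertex set.\<close>
  have "strongly_connected (with_proj T)"
    using assms T.symmetric_connected_imp_strongly_connected T.pair_sym_arcs
    by (simp add: tree_graph_def)
  then have ne: "pverts T \<noteq> {}"
    and reach: "\<And>u v. u \<in> pverts T \<Longrightarrow> v \<in> pverts T \<Longrightarrow> u \<rightarrow>\<^sup>*\<^bsub>with_proj T\<^esub> v"
    by (auto simp: strongly_connected_def)
  define built where "built S \<longleftrightarrow> leaf_built (parcs T) S \<and> S \<subseteq> pverts T" for S
  obtain r where r: "r \<in> pverts T" using ne by blast
  have built_r: "built {r}"
    using r by (simp add: built_def leaf_built_singleton)
  have "\<forall>S. built S \<longrightarrow> card S < Suc (card (pverts T))"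
    by (auto simp: built_def less_Suc_eq_le intro: card_mono T.pair_finite_verts)
  then obtain S where S: "built S" and max: "\<And>S'. built S' \<Longrightarrow> card S' \<le> card S"
    using ex_has_greatest_nat[of built "{r}" card "Suc (card (pverts T))"] built_r by auto
  have finS: "finite S" using S by (auto simp: built_def leaf_built_finite)
  have "S \<noteq> {}" using max[OF built_r] by auto
  then obtain s where s: "s \<in> S" by blast
  have "v \<in> S" if "v \<in> pverts T" for v
  proof (rule ccontr)
    assume "v \<notin> S"
    \<comment> \<open>Otherwise no arc leaves \<open>S\<close>, and everything reachable from
      \<open>s\<close> stays inside, including \<open>v\<close>.\<close>
    have "\<exists>p l. p \<in> S \<and> l \<notin> S \<and> (p, l) \<in> parcs T"
    proof (rule ccontr)
      assume closed: "\<not> ?thesis"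
      have "s \<rightarrow>\<^sup>*\<^bsub>with_proj T\<^esub> v" using s S that reach by (auto simp: built_def)
      then have "v \<in> S"
        by (induction rule: T.reachable_induct) (use s closed in auto)
      with \<open>v \<notin> S\<close> show False by simp
    qed
    then obtain p l where pl: "p \<in> S" "l \<notin> S" "(p, l) \<in> parcs T" by blast
    have "q = p" if q: "q \<in> S" "(q, l) \<in> parcs T" for q
    proof (rule ccontr)
      assume "q \<noteq> p"
      obtain c where "T.apath p c q" "set (pawalk_verts p c) \<subseteq> S"
        using T.leaf_built_apath S pl(1) q(1) by (metis built_def)
      with T.cycle_of_apath[of p c q l] \<open>q \<noteq> p\<close> pl q acyclic show False by auto
    qed
    then have "built (insert l S)"
      using S pl T.in_arcsD2[OF pl(3)] by (auto simp: built_def intro: leaf_built_insert)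
    from max[OF this] pl(2) finS show False by simp
  qed
  with S have "S = pverts T" by (auto simp: built_def)
  with S show ?thesis by (simp add: built_def)
qed

section \<open>From tree distances to homomorphism densities\<close>

theorem theorem6:
  fixes \<delta> :: "'b pair_pre_digraph \<Rightarrow> 'c pair_pre_digraph \<Rightarrow> real"
    and T :: "'a pair_pre_digraph"
    and \<epsilon> :: real
  assumes "\<delta> = tree_cut_dist \<or> \<delta> = tree_spectral_dist"
    and "tree_graph T"
    and "\<epsilon> > 0"
  shows "\<exists>\<eta>>0. \<forall>(G :: 'b pair_pre_digraph) (H :: 'c pair_pre_digraph).
           pair_graph G \<longrightarrow> pverts G \<noteq> {} \<longrightarrow> pair_graph H \<longrightarrow> pverts H \<noteq> {} \<longrightarrow>
           \<delta> G H \<le> \<eta> \<longrightarrow> \<bar>hom_density T G - hom_density T H\<bar> \<le> \<epsilon>"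
proof -
  have T: "pair_graph T" using assms(2) by (simp add: tree_graph_def)
  interpret T: pair_graph T by fact
  have symT: "sym (parcs T)" by (auto intro!: symI T.arcs_symmetric)
  have irreflT: "irrefl (parcs T)" by (auto simp: irrefl_def dest: T.pair_no_loops)
  obtain \<eta> where \<eta>: "\<eta> > 0" and
    stable: "\<And>(G :: 'b pair_pre_digraph) (H :: 'c pair_pre_digraph) X g k.
      \<lbrakk>pair_graph G; pverts G \<noteq> {}; pair_graph H; pverts H \<noteq> {};
      X \<in> fractional_overlays G H; cut_defect G H X \<le> \<eta>;
      \<forall>w\<in>pverts T. (\<forall>u\<in>pverts G. g w u \<in> {0..1}) \<and> (\<forall>v\<in>pverts H. k w v \<in> {0..1}) \<and>
        overlay_gap G H X (g w) (k w) \<le> \<eta>\<rbrakk> \<Longrightarrow>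
      \<bar>weighted_hom_density (pverts T) (parcs T) G g - weighted_hom_density (pverts T) (parcs T) H k\<bar> \<le> \<epsilon>"
    using weighted_hom_density_stable[OF tree_graph_leaf_built[OF assms(2)] symT irreflT assms(3)]
    by metis
  show ?thesis
  \<comment> \<open>Halving makes the bound on the infimum strict, so some overlay itself has defect
    at most \<open>\<eta>\<close>.\<close>
  proof (intro exI[of _ "\<eta> / 2"] conjI allI impI)
    fix G :: "'b pair_pre_digraph" and H :: "'c pair_pre_digraph"
    assume G: "pair_graph G" "pverts G \<noteq> {}" and H: "pair_graph H" "pverts H \<noteq> {}"
      and le: "\<delta> G H \<le> \<eta> / 2"
    interpret G: pair_graph G by fact
    interpret H: pair_graph H by fact
    have "\<delta> G H < \<eta>" using le \<eta> by simp
    then obtain X where "X \<in> fractional_overlays G H" "cut_defect G H X \<le> \<eta>"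
      using cut_defect_le_of_tree_dist[OF assms(1) G.pair_finite_verts G(2) H.pair_finite_verts H(2)]
      by blast
    \<comment> \<open>With all weights equal to 1 every gap is 0, so only the defect has to be
      small.\<close>
    from stable[OF G H this, of "\<lambda>_ _. 1" "\<lambda>_ _. 1"] \<eta>
    show "\<bar>hom_density T G - hom_density T H\<bar> \<le> \<epsilon>"
      by (simp add: hom_density_eq_weighted[OF T G.pair_finite_verts]
        hom_density_eq_weighted[OF T H.pair_finite_verts] overlay_gap_def)
  qed (use \<eta> in simp)
qed

end
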